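(* Let $G$ be a disconnected graph with exactly $t$ trivial connected components (components with one vertex). Then $\mathrm{h}_m(G\overline{G})=2$ if $t=0$, and $\mathrm{h}_m(G\overline{G})=t+1$ otherwise.
   Context: All graphs are finite, simple and undirected. The complementary prism $G\overline{G}$ of a graph $G$ is obtained from the disjoint union of $G$ and its complement $\overline{G}$ by adding the edges of the perfect matching joining each vertex $u$ of $G$ to its copy $\overline{u}$ in $\overline{G}$. A path is monophonic if it is an induced (chordless) path. A set $S$ of vertices of a graph $H$ is monophonic convex if it contains every vertex of every monophonic path between two vertices of $S$. The monophonic convex hull $[S]_H$ of $S\subseteq V(H)$ is the smallest monophonic convex set of $H$ containing $S$. A set $S$ is an $m$-hull set of $H$ if $[S]_H=V(H)$; the monophonic hull number $\mathrm{h}_m(H)$ is the minimum cardinality of an $m$-hull set of $H$.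
   Formalization: The formal theorem additionally assumes that G has at least one edge; for an edgeless graph on n ≥ 2 vertices, t = n and the hull number of the complementary prism is n, not t+1, so the claim as printed fails there. *)

theory Defs
  imports "Graph_Theory.Graph_Theory"
begin

text \<open>
  A finite, simple, undirected graph is a \<open>pair_graph\<close>: its arc relation is finite,
  symmetric and irreflexive, so the edge between \<open>u\<close> and \<open>v\<close> is the pair of arcs
  \<open>(u, v)\<close>, \<open>(v, u)\<close>.
\<close>

definition graph_complement :: "'a pair_pre_digraph \<Rightarrow> 'a pair_pre_digraph" where
  "graph_complement G = \<lparr>pverts = pverts G,
     parcs = {(u, v). u \<in> pverts G \<and> v \<in> pverts G \<and> u \<noteq> v \<and> (u, v) \<notin> parcs G}\<rparr>"

text \<open>\<open>Inl u\<close> is the vertex \<open>u\<close> of \<open>G\<close>, and \<open>Inr u\<close> is its copy in the complement.\<close>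

definition complementary_prism :: "'a pair_pre_digraph \<Rightarrow> ('a + 'a) pair_pre_digraph" where
  "complementary_prism G = \<lparr>pverts = pverts G <+> pverts G,
     parcs = {(Inl u, Inl v) | u v. (u, v) \<in> parcs G}
           \<union> {(Inr u, Inr v) | u v. (u, v) \<in> parcs (graph_complement G)}
           \<union> {(Inl u, Inr u) | u. u \<in> pverts G}
           \<union> {(Inr u, Inl u) | u. u \<in> pverts G}\<rparr>"

text \<open>
  In a symmetric digraph the strongly connected components are the connected components
  of the underlying undirected graph.
\<close>

definition trivial_components :: "'a pair_pre_digraph \<Rightarrow> ('a, 'a \<times> 'a) pre_digraph set" where
  "trivial_components G = {C \<in> pre_digraph.sccs (with_proj G). card (verts C) = 1}"

text \<open>
  A path is given by its list of vertices. A chord joins two vertices of the path that are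
  not consecutive on it; by symmetry only pairs in path order are inspected.
\<close>

definition monophonic_path :: "'a pair_pre_digraph \<Rightarrow> 'a list \<Rightarrow> bool" where
  "monophonic_path H p \<longleftrightarrow> vpath p (with_proj H) \<and>
     (\<forall>i j. Suc i < j \<and> j < length p \<longrightarrow> (p ! i, p ! j) \<notin> parcs H)"

definition monophonic_convex :: "'a pair_pre_digraph \<Rightarrow> 'a set \<Rightarrow> bool" where
  "monophonic_convex H S \<longleftrightarrow> S \<subseteq> pverts H \<and>
     (\<forall>p. monophonic_path H p \<and> hd p \<in> S \<and> last p \<in> S \<longrightarrow> set p \<subseteq> S)"

definition monophonic_hull :: "'a pair_pre_digraph \<Rightarrow> 'a set \<Rightarrow> 'a set" where
  "monophonic_hull H S = \<Inter>{C. monophonic_convex H C \<and> S \<subseteq> C}"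

definition m_hull_set :: "'a pair_pre_digraph \<Rightarrow> 'a set \<Rightarrow> bool" where
  "m_hull_set H S \<longleftrightarrow> S \<subseteq> pverts H \<and> monophonic_hull H S = pverts H"

definition monophonic_hull_number :: "'a pair_pre_digraph \<Rightarrow> nat" where
  "monophonic_hull_number H = (LEAST k. \<exists>S. m_hull_set H S \<and> card S = k)"

lemma complementary_prism_simps [simp]:
  "pverts (complementary_prism G) = pverts G <+> pverts G"
  "(Inl u, Inl v) \<in> parcs (complementary_prism G) \<longleftrightarrow> (u, v) \<in> parcs G"
  "(Inr u, Inr v) \<in> parcs (complementary_prism G) \<longleftrightarrow>
     u \<in> pverts G \<and> v \<in> pverts G \<and> u \<noteq> v \<and> (u, v) \<notin> parcs G"
  "(Inl u, Inr v) \<in> parcs (complementary_prism G) \<longleftrightarrow> u = v \<and> u \<in> pverts G"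
  "(Inr u, Inl v) \<in> parcs (complementary_prism G) \<longleftrightarrow> u = v \<and> u \<in> pverts G"
  by (auto simp: complementary_prism_def graph_complement_def)

lemma pair_graph_complementary_prism:
  assumes "pair_graph G"
  shows "pair_graph (complementary_prism G)"
proof -
  interpret pair_graph G by fact
  let ?P = "complementary_prism G"
  have symG: "(u, v) \<in> parcs G \<longleftrightarrow> (v, u) \<in> parcs G" for u v
    using pair_sym_arcs unfolding symmetric_def sym_def with_proj_simps by blast
  have noloop: "(u, u) \<notin> parcs G" for u
    using pair_no_loops[of "(u, u)"] by auto
  have arc: "x \<in> pverts ?P \<and> y \<in> pverts ?P \<and> x \<noteq> y \<and> (y, x) \<in> parcs ?P"
    if "(x, y) \<in> parcs ?P" for x y
    using that symG[of "projl x" "projl y"] symG[of "projr x" "projr y"] noloop[of "projl x"]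
      in_arcsD1[of "projl x" "projl y"] in_arcsD2[of "projl x" "projl y"]
    by (cases x; cases y) auto
  have fin: "finite (pverts ?P)"
    by (simp add: pair_finite_verts)
  have sub: "parcs ?P \<subseteq> pverts ?P \<times> pverts ?P"
    using arc by (metis mem_Sigma_iff subrelI)
  show ?thesis
  proof
    show "finite (parcs ?P)"
      by (rule finite_subset[OF sub]) (use fin in blast)
    show "symmetric ?P"
      unfolding symmetric_def sym_def with_proj_simps using arc by metis
    show "fst e \<noteq> snd e" if "e \<in> parcs ?P" for e
      using arc[of "fst e" "snd e"] that by simp
    show "fst e \<in> pverts ?P" if "e \<in> parcs ?P" for e
      using arc[of "fst e" "snd e"] that by simp
    show "snd e \<in> pverts ?P" if "e \<in> parcs ?P" for e
      using arc[of "fst e" "snd e"] that by simp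
  qed (rule fin)
qed

lemma monophonic_hull_least:
  assumes "S \<subseteq> pverts H"
  shows "monophonic_convex H (monophonic_hull H S)"
    and "S \<subseteq> monophonic_hull H S"
    and "monophonic_convex H C \<Longrightarrow> S \<subseteq> C \<Longrightarrow> monophonic_hull H S \<subseteq> C"
proof -
  have V: "monophonic_convex H (pverts H)"
    by (simp add: monophonic_convex_def monophonic_path_def vpath_def vwalk_def)
  show "monophonic_convex H (monophonic_hull H S)"
    unfolding monophonic_convex_def
  proof (intro conjI allI impI)
    show "monophonic_hull H S \<subseteq> pverts H"
      using V assms by (simp add: monophonic_hull_def Inter_lower)
    fix p assume p: "monophonic_path H p \<and> hd p \<in> monophonic_hull H S \<and> last p \<in> monophonic_hull H S"
    show "set p \<subseteq> monophonic_hull H S"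
      unfolding monophonic_hull_def
    proof (rule Inter_greatest)
      fix C assume "C \<in> {C. monophonic_convex H C \<and> S \<subseteq> C}"
      then show "set p \<subseteq> C"
        using p by (simp add: monophonic_hull_def monophonic_convex_def)
    qed
  qed
qed (auto simp: monophonic_hull_def)

end

theory Submission
  imports Defs
begin

text \<open>
  An isolated vertex \<open>v\<close> of \<open>G\<close> has degree one in the prism, so it lies in every hull set; the
  isolated vertices together with their copies form a convex set, so they do not suffice. For the
  upper bound, take \<open>u\<close> non-isolated and \<open>v\<close> in another component. For every neighbour \<open>a\<close> of \<open>u\<close>
  the induced path \<open>u, a, a', v'\<close> (a prime denotes the copy in the complement) puts \<open>a\<close> and \<open>a'\<close>
  into the hull, and \<open>u', w', a'\<close> is induced whenever \<open>w\<close> is adjacent to neither \<open>u\<close> nor \<open>a\<close>.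
  This yields the whole complement, and then \<open>w', w, x, x'\<close> yields both ends of every edge of \<open>G\<close>.
\<close>

section \<open>Paths leaving a set, and a criterion for convexity\<close>

lemma nth_mem_vwalk_arcs:
  "Suc i < length p \<Longrightarrow> (p ! i, p ! Suc i) \<in> set (vwalk_arcs p)"
proof (induction p arbitrary: i rule: vwalk_arcs.induct)
  case (3 x y xs)
  then show ?case by (cases i) auto
qed auto

text \<open>The first and the last vertex of the path outside \<open>S\<close> serve as
  \<open>x'\<close> and \<open>y'\<close>, which may coincide; \<open>x\<close> directly precedes
  the first and \<open>y\<close> directly follows the last.\<close>

lemma monophonic_path_boundary:
  assumes p: "monophonic_path H p" and "symmetric (with_proj H)"
    and hd: "hd p \<in> S" and last: "last p \<in> S" and out: "\<not> set p \<subseteq> S"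
  obtains x y x' y' where "x \<in> S" "y \<in> S" "x \<noteq> y" "(x, y) \<notin> parcs H"
    "x' \<in> pverts H - S" "y' \<in> pverts H - S" "(x, x') \<in> parcs H" "(y, y') \<in> parcs H"
proof -
  have walk: "vwalk p (with_proj H)" and dist: "distinct p"
    using p by (auto simp: monophonic_path_def vpath_def)
  then have ne: "p \<noteq> []" and verts: "set p \<subseteq> pverts H"
    by (auto simp: vwalk_def)
  have arc: "(p ! i, p ! Suc i) \<in> parcs H" if "Suc i < length p" for i
    using nth_mem_vwalk_arcs[OF that] walk by (auto simp: vwalk_def)
  have sym: "(y, x) \<in> parcs H" if "(x, y) \<in> parcs H" for x y
    using that assms(2) by (auto simp: symmetric_def sym_def)
  let ?I = "{i. i < length p \<and> p ! i \<notin> S}"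
  have fin: "finite ?I" by simp
  have nonempty: "?I \<noteq> {}"
    using out by (auto simp: in_set_conv_nth)
  define i where "i = Min ?I"
  define j where "j = Max ?I"
  have i: "i < length p" "p ! i \<notin> S" and j: "j < length p" "p ! j \<notin> S" and "i \<le> j"
    using Min_in[OF fin nonempty] Max_in[OF fin nonempty] Min_le[OF fin]
    by (auto simp: i_def j_def)
  have "i \<noteq> 0"
    using i hd ne by (metis hd_conv_nth)
  then obtain k where k: "i = Suc k" by (cases i) auto
  have kS: "p ! k \<in> S"
  proof (rule ccontr)
    assume "p ! k \<notin> S"
    then have "i \<le> k"
      unfolding i_def using k i by (intro Min_le[OF fin]) auto
    then show False using k by simp
  qed
  have jl: "Suc j < length p"
    using j last ne by (metis Suc_lessI diff_Suc_1 last_conv_nth)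
  have jS: "p ! Suc j \<in> S"
  proof (rule ccontr)
    assume "p ! Suc j \<notin> S"
    then have "Suc j \<le> j"
      using Max_ge[OF fin, folded j_def] jl by auto
    then show False by simp
  qed
  show thesis
  proof (rule that[of "p ! k" "p ! Suc j" "p ! i" "p ! j"])
    \<comment> \<open>As \<open>k < i \<le> j\<close>, the positions \<open>k\<close> and
      \<open>Suc j\<close> differ by at least two. Hence the two vertices are distinct, and an edge
      between them would be a chord.\<close>
    show "p ! k \<noteq> p ! Suc j"
      using dist jl k \<open>i \<le> j\<close> by (simp add: nth_eq_iff_index_eq)
    show "(p ! k, p ! Suc j) \<notin> parcs H"
      using p jl k \<open>i \<le> j\<close> by (auto simp: monophonic_path_def)
    show "p ! i \<in> pverts H - S" "p ! j \<in> pverts H - S"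
      using verts i j by auto
  qed (use kS jS arc i j jl k sym in auto)
qed

text \<open>An induced path that leaves \<open>S\<close> and returns passes through two distinct
  nonadjacent vertices of \<open>S\<close> with neighbours outside \<open>S\<close>. This is
  impossible if all such vertices form a clique.\<close>

lemma monophonic_convex_if_boundary_clique:
  assumes "symmetric (with_proj H)" and "S \<subseteq> pverts H"
    and "\<And>x y x' y'. x \<in> S \<Longrightarrow> y \<in> S \<Longrightarrow> x' \<in> pverts H - S \<Longrightarrow> y' \<in> pverts H - S \<Longrightarrow>
      (x, x') \<in> parcs H \<Longrightarrow> (y, y') \<in> parcs H \<Longrightarrow> x \<noteq> y \<Longrightarrow> (x, y) \<in> parcs H"
  shows "monophonic_convex H S"
  unfolding monophonic_convex_def
proof (intro conjI allI impI)
  fix p assume "monophonic_path H p \<and> hd p \<in> S \<and> last p \<in> S"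
  then show "set p \<subseteq> S"
    using monophonic_path_boundary[of H p S] assms by metis
qed (rule assms)

text \<open>The tool for lower bounds: a proper convex set containing \<open>S\<close> would also
  contain its hull.\<close>

lemma m_hull_set_not_subset_convex:
  assumes "m_hull_set H S" and "monophonic_convex H C" and "C \<noteq> pverts H"
  shows "\<not> S \<subseteq> C"
  using assms monophonic_hull_least(3)[of S H C]
  by (auto simp: m_hull_set_def monophonic_convex_def)

section \<open>Short induced paths between vertices of a convex set\<close>

lemma monophonic_convex_path3:
  assumes "monophonic_convex H S" "pair_graph H" "x \<in> S" "z \<in> S"
    and "(x, y) \<in> parcs H" "(y, z) \<in> parcs H" "x \<noteq> z" "(x, z) \<notin> parcs H"
  shows "y \<in> S"
proof -
  interpret pair_graph H by fact
  have "monophonic_path H [x, y, z]"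
    using assms pair_no_loops wellformed'
    by (force simp: monophonic_path_def vpath_def vwalk_def less_Suc_eq numeral_3_eq_3)
  then show ?thesis
    using assms by (force simp: monophonic_convex_def)
qed

lemma monophonic_convex_path4:
  assumes "monophonic_convex H S" "pair_graph H" "w \<in> S" "z \<in> S"
    and "(w, x) \<in> parcs H" "(x, y) \<in> parcs H" "(y, z) \<in> parcs H"
    and "w \<noteq> y" "w \<noteq> z" "x \<noteq> z" "(w, y) \<notin> parcs H" "(w, z) \<notin> parcs H" "(x, z) \<notin> parcs H"
  shows "x \<in> S" "y \<in> S"
proof -
  interpret pair_graph H by fact
  have "w \<noteq> x" "x \<noteq> y" "y \<noteq> z"
    using assms(5-7) pair_no_loops by force+
  moreover have "{w, x, y, z} \<subseteq> pverts H"
    using assms(5-7) wellformed' by blast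
  ultimately have "monophonic_path H [w, x, y, z]"
    using assms
    by (auto simp: monophonic_path_def vpath_def vwalk_def less_Suc_eq)
  then have "set [w, x, y, z] \<subseteq> S"
    using assms(1,3,4) unfolding monophonic_convex_def by fastforce
  then show "x \<in> S" "y \<in> S" by auto
qed

section \<open>Isolated vertices and trivial components\<close>

definition isolated_verts :: "'a pair_pre_digraph \<Rightarrow> 'a set" where
  "isolated_verts G = {v \<in> pverts G. \<forall>w. (v, w) \<notin> parcs G}"

context pair_graph
begin

lemma parcs_sym: "(u, v) \<in> parcs G \<longleftrightarrow> (v, u) \<in> parcs G"
  using pair_sym_arcs unfolding symmetric_def sym_def with_proj_simps by blast

lemma parcs_irrefl: "(u, u) \<notin> parcs G"
  using pair_no_loops[of "(u, u)"] by auto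

lemma card_trivial_components:
  "card (trivial_components G) = card (isolated_verts G)"
proof -
  \<comment> \<open>Components are subgraphs, but each is determined by its vertex set, so it
    suffices to count vertex sets.\<close>
  have "verts ` trivial_components G = {S \<in> sccs_verts. card S = 1}"
    by (auto simp: trivial_components_def sccs_verts_conv)
  moreover have "inj_on verts (trivial_components G)"
    using inj_on_verts_sccs by (rule inj_on_subset) (auto simp: trivial_components_def)
  ultimately have "card (trivial_components G) = card {S \<in> sccs_verts. card S = 1}"
    by (metis card_image)
  also have "{S \<in> sccs_verts. card S = 1} = (\<lambda>v. {v}) ` isolated_verts G"
  proof (intro equalityI subsetI)
    fix S assume "S \<in> {S \<in> sccs_verts. card S = 1}"
    then obtain v where v: "S = {v}" "{v} \<in> sccs_verts"
      by (auto simp: card_1_singleton_iff)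
    \<comment> \<open>By symmetry a neighbour \<open>w\<close> and \<open>v\<close> reach each
      other, so \<open>w\<close> would belong to the component of \<open>v\<close>.\<close>
    have "(v, w) \<notin> parcs G" for w
    proof
      assume vw: "(v, w) \<in> parcs G"
      then have "v \<rightarrow>\<^sup>*\<^bsub>with_proj G\<^esub> w" "w \<rightarrow>\<^sup>*\<^bsub>with_proj G\<^esub> v"
        using parcs_sym by auto
      moreover have "w \<noteq> v" using vw parcs_irrefl by auto
      ultimately show False
        using v(2) by (auto simp: in_sccs_verts_conv_reachable)
    qed
    then show "S \<in> (\<lambda>v. {v}) ` isolated_verts G"
      using v sccs_verts_subsets[of S] by (auto simp: isolated_verts_def)
  next
    fix S assume "S \<in> (\<lambda>v. {v}) ` isolated_verts G"
    then obtain v where v: "S = {v}" "v \<in> pverts G" "\<And>w. (v, w) \<notin> parcs G"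
      by (auto simp: isolated_verts_def)
    have "w = v" if "v \<rightarrow>\<^sup>*\<^bsub>with_proj G\<^esub> w" for w
      using that v(3) by (auto elim: converse_reachable_cases)
    then show "S \<in> {S \<in> sccs_verts. card S = 1}"
      using v by (auto simp: in_sccs_verts_conv_reachable)
  qed
  also have "card \<dots> = card (isolated_verts G)"
    by (simp add: card_image)
  finally show ?thesis .
qed

section \<open>Lower bounds for hull sets of the prism\<close>

lemma symmetric_complementary_prism: "symmetric (with_proj (complementary_prism G))"
proof -
  interpret P: pair_graph "complementary_prism G"
    by (rule pair_graph_complementary_prism) unfold_locales
  show ?thesis by (rule P.pair_sym_arcs)
qed

lemma isolated_mem_m_hull_set:
  assumes "m_hull_set (complementary_prism G) S" and v: "v \<in> isolated_verts G"
  shows "Inl v \<in> S"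
proof (rule ccontr)
  let ?P = "complementary_prism G"
  assume "Inl v \<notin> S"
  then have "S \<subseteq> pverts ?P - {Inl v}"
    using assms(1) by (auto simp: m_hull_set_def)
  \<comment> \<open>The only neighbour of \<open>Inl v\<close> is \<open>Inr v\<close>, so the
    boundary is a single vertex and trivially a clique.\<close>
  moreover have "monophonic_convex ?P (pverts ?P - {Inl v})"
  proof (rule monophonic_convex_if_boundary_clique[OF symmetric_complementary_prism])
    fix x y x' y'
    assume "x' \<in> pverts ?P - (pverts ?P - {Inl v})" "y' \<in> pverts ?P - (pverts ?P - {Inl v})"
      "(x, x') \<in> parcs ?P" "(y, y') \<in> parcs ?P" "x \<noteq> y"
    then have "(x, Inl v) \<in> parcs ?P" "(y, Inl v) \<in> parcs ?P" by auto
    then have "x = Inr v" "y = Inr v"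
      using v parcs_sym by (cases x; cases y; auto simp: isolated_verts_def)+
    then show "(x, y) \<in> parcs ?P" using \<open>x \<noteq> y\<close> by simp
  qed auto
  ultimately show False
    using m_hull_set_not_subset_convex[OF assms(1)] v by (auto simp: isolated_verts_def)
qed

text \<open>Only the copies \<open>Inr v\<close> have neighbours outside this set, and copies of
  isolated vertices are pairwise adjacent in the complement.\<close>

lemma monophonic_convex_isolated:
  "monophonic_convex (complementary_prism G) (isolated_verts G <+> isolated_verts G)"
proof (rule monophonic_convex_if_boundary_clique[OF symmetric_complementary_prism])
  let ?P = "complementary_prism G" and ?S = "isolated_verts G <+> isolated_verts G"
  have Inr: "\<exists>v \<in> isolated_verts G. x = Inr v"
    if "x \<in> ?S" "x' \<in> pverts ?P - ?S" "(x, x') \<in> parcs ?P" for x x'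
    using that by (cases x; cases x') (auto simp: isolated_verts_def)
  fix x y x' y'
  assume "x \<in> ?S" "y \<in> ?S" "x' \<in> pverts ?P - ?S" "y' \<in> pverts ?P - ?S"
    "(x, x') \<in> parcs ?P" "(y, y') \<in> parcs ?P" "x \<noteq> y"
  then show "(x, y) \<in> parcs ?P"
    using Inr[of x x'] Inr[of y y'] by (auto simp: isolated_verts_def)
qed (auto simp: isolated_verts_def)

text \<open>All isolated vertices are forced into \<open>S\<close>. They cannot be all of
  \<open>S\<close>, since they lie in the convex set above, which is proper because it misses the
  ends of any edge of \<open>G\<close>.\<close>

lemma card_isolated_less_m_hull_set:
  assumes "m_hull_set (complementary_prism G) S" and "parcs G \<noteq> {}"
  shows "card (isolated_verts G) < card S"
proof -
  let ?P = "complementary_prism G"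
  have "finite S"
    using assms(1) by (auto simp: m_hull_set_def intro: finite_subset)
  moreover have "Inl ` isolated_verts G \<subseteq> S"
    using isolated_mem_m_hull_set[OF assms(1)] by auto
  moreover have "S \<noteq> Inl ` isolated_verts G"
  proof -
    obtain u v where "(u, v) \<in> parcs G" using assms(2) by auto
    then have "u \<in> pverts G" "u \<notin> isolated_verts G"
      using in_arcsD1 by (auto simp: isolated_verts_def)
    then have "isolated_verts G <+> isolated_verts G \<noteq> pverts ?P"
      by (auto simp: set_eq_iff)
    then show ?thesis
      using m_hull_set_not_subset_convex[OF assms(1) monophonic_convex_isolated] by auto
  qed
  ultimately have "card (Inl ` isolated_verts G :: ('a + 'a) set) < card S"
    by (intro psubset_card_mono) auto
  then show ?thesis by (simp add: card_image)
qed

lemma card_m_hull_set_ge_2: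
  assumes "m_hull_set (complementary_prism G) S" and "parcs G \<noteq> {}"
  shows "2 \<le> card S"
proof (rule ccontr)
  let ?P = "complementary_prism G"
  obtain u v where uv: "(u, v) \<in> parcs G" using assms(2) by auto
  have "finite S"
    using assms(1) by (auto simp: m_hull_set_def intro: finite_subset)
  moreover assume "\<not> 2 \<le> card S"
  ultimately have single: "x = y" if "x \<in> S" "y \<in> S" for x y
    using that card_le_Suc0_iff_eq[of S] by auto
  \<comment> \<open>With at most one vertex in \<open>S\<close>, no two distinct boundary vertices
    exist, and the clique condition is vacuous.\<close>
  have "monophonic_convex ?P S"
    by (rule monophonic_convex_if_boundary_clique[OF symmetric_complementary_prism])
      (use assms(1) single in \<open>auto simp: m_hull_set_def\<close>)
  then have "S = pverts ?P"
    using m_hull_set_not_subset_convex[OF assms(1), of S] by auto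
  moreover have "Inl u \<in> pverts ?P" "Inr u \<in> pverts ?P"
    using uv in_arcsD1 by auto
  ultimately show False using single[of "Inl u" "Inr u"] by auto
qed

section \<open>Upper bound: convex sets meeting two components of \<open>G\<close>\<close>

lemma convex_contains_copies:
  assumes conv: "monophonic_convex (complementary_prism G) S"
    and uv: "Inl u \<in> S" "Inl v \<in> S" "\<not> u \<rightarrow>\<^sup>*\<^bsub>with_proj G\<^esub> v"
  shows "Inr u \<in> S" "Inr v \<in> S"
proof -
  have P: "pair_graph (complementary_prism G)"
    by (rule pair_graph_complementary_prism) unfold_locales
  have mem: "u \<in> pverts G" "v \<in> pverts G"
    using conv uv by (auto simp: monophonic_convex_def)
  \<comment> \<open>These two facts make \<open>Inl u\<close>, \<open>Inr u\<close>,
    \<open>Inr v\<close>, \<open>Inl v\<close> an induced path.\<close>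
  then have "u \<noteq> v" "(u, v) \<notin> parcs G" using uv by auto
  then show "Inr u \<in> S" "Inr v \<in> S"
    using monophonic_convex_path4[OF conv P uv(1,2), of "Inr u" "Inr v"] mem by auto
qed

text \<open>The last conclusion lets the lemma be applied again with \<open>a\<close> in the role of
  \<open>u\<close>, so that neighbours of neighbours are reached as well.\<close>

lemma convex_contains_neighbours:
  assumes conv: "monophonic_convex (complementary_prism G) S"
    and uv: "Inl u \<in> S" "Inl v \<in> S" "\<not> u \<rightarrow>\<^sup>*\<^bsub>with_proj G\<^esub> v" and ua: "(u, a) \<in> parcs G"
  shows "Inl a \<in> S" "Inr a \<in> S" "\<not> a \<rightarrow>\<^sup>*\<^bsub>with_proj G\<^esub> v"
proof -
  have P: "pair_graph (complementary_prism G)"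
    by (rule pair_graph_complementary_prism) unfold_locales
  have mem: "u \<in> pverts G" "v \<in> pverts G" "a \<in> pverts G"
    using conv uv ua in_arcsD2 by (auto simp: monophonic_convex_def)
  show nr: "\<not> a \<rightarrow>\<^sup>*\<^bsub>with_proj G\<^esub> v"
    using uv(3) ua adj_reachable_trans[of u a v] by auto
  then have "a \<noteq> v" "(a, v) \<notin> parcs G" "u \<noteq> v" "u \<noteq> a"
    using uv ua mem parcs_irrefl by auto
  then show "Inl a \<in> S" "Inr a \<in> S"
    using monophonic_convex_path4[OF conv P uv(1) convex_contains_copies(2)[OF conv uv],
        of "Inl a" "Inr a"] mem ua by auto
qed

lemma convex_contains_nonisolated:
  assumes conv: "monophonic_convex (complementary_prism G) S"
    and uv: "Inl u \<in> S" "Inl v \<in> S" "\<not> u \<rightarrow>\<^sup>*\<^bsub>with_proj G\<^esub> v" and ua: "(u, a) \<in> parcs G"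
  shows "(pverts G - isolated_verts G) <+> pverts G \<subseteq> S"
proof -
  have P: "pair_graph (complementary_prism G)"
    by (rule pair_graph_complementary_prism) unfold_locales
  note a = convex_contains_neighbours[OF conv uv ua]
  note u' = convex_contains_copies(1)[OF conv uv]
  have Inr: "Inr w \<in> S" if w: "w \<in> pverts G" for w
  \<comment> \<open>These are exactly the \<open>w\<close> for which \<open>Inr u\<close>,
    \<open>Inr w\<close>, \<open>Inr a\<close> is not an induced path. For \<open>w\<close> adjacent
    to \<open>a\<close>, the neighbour lemma is used a second time, starting from
    \<open>a\<close>.\<close>
  proof (cases "w = u \<or> w = a \<or> (u, w) \<in> parcs G \<or> (a, w) \<in> parcs G")
    case True
    then show ?thesis
      using u' a convex_contains_neighbours[OF conv uv]
        convex_contains_neighbours[OF conv a(1) uv(2) a(3)] by auto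
  next
    case False
    have "u \<noteq> a" using ua parcs_irrefl by auto
    then show ?thesis
      using False w ua in_arcsD1[OF ua] in_arcsD2[OF ua] parcs_sym
      by (intro monophonic_convex_path3[OF conv P u' a(2)]) auto
  qed
  \<comment> \<open>The path \<open>Inr w\<close>, \<open>Inl w\<close>, \<open>Inl x\<close>,
    \<open>Inr x\<close> has no chord: the edge \<open>wx\<close> of \<open>G\<close> is absent from
    the complement.\<close>
  have "Inl w \<in> S" if "(w, x) \<in> parcs G" for w x
  proof -
    have "w \<in> pverts G" "x \<in> pverts G" "w \<noteq> x"
      using that in_arcsD1 in_arcsD2 parcs_irrefl by auto
    then show ?thesis
      using that monophonic_convex_path4(1)[OF conv P Inr Inr, of w x "Inl w" "Inl x"] by auto
  qed
  then show ?thesis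
    using Inr by (auto simp: isolated_verts_def)
qed

text \<open>Growth from \<open>u\<close> and \<open>v\<close> yields everything except the vertices
  \<open>Inl w\<close> with \<open>w\<close> isolated, and those are put into \<open>S\<close> from
  the start.\<close>

lemma m_hull_setI:
  assumes "S \<subseteq> pverts (complementary_prism G)" and "Inl ` isolated_verts G \<subseteq> S"
    and "Inl u \<in> S" "Inl v \<in> S" "\<not> u \<rightarrow>\<^sup>*\<^bsub>with_proj G\<^esub> v" "(u, a) \<in> parcs G"
  shows "m_hull_set (complementary_prism G) S"
proof -
  let ?P = "complementary_prism G" and ?C = "monophonic_hull (complementary_prism G) S"
  have conv: "monophonic_convex ?P ?C" and sub: "S \<subseteq> ?C"
    using monophonic_hull_least[OF assms(1)] by auto
  have "(pverts G - isolated_verts G) <+> pverts G \<subseteq> ?C"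
    using convex_contains_nonisolated[OF conv] assms sub by blast
  then have "pverts ?P \<subseteq> ?C"
    using assms(2) sub by auto
  then show ?thesis
    using assms(1) conv by (auto simp: m_hull_set_def monophonic_convex_def)
qed

lemma obtain_small_m_hull_set:
  assumes "\<not> connected (with_proj G)" and "parcs G \<noteq> {}"
  obtains S where "m_hull_set (complementary_prism G) S"
    "card S = (if isolated_verts G = {} then 2 else card (isolated_verts G) + 1)"
proof (cases "isolated_verts G = {}")
  case True
  obtain u v where uv: "u \<in> pverts G" "v \<in> pverts G" "\<not> u \<rightarrow>\<^sup>*\<^bsub>with_proj G\<^esub> v"
  proof -
    \<comment> \<open>The empty graph also counts as not connected, so it must be ruled out before
      two mutually unreachable vertices can be found.\<close>
    have "pverts G \<noteq> {}" using assms(2) in_arcsD1 by fastforce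
    then show thesis
      using that assms(1) connectedI reachable_mk_symmetricI by auto
  qed
  obtain a where "(u, a) \<in> parcs G"
    using True uv(1) by (auto simp: isolated_verts_def)
  then have "m_hull_set (complementary_prism G) {Inl u, Inl v}"
    using m_hull_setI[of "{Inl u, Inl v}" u v a] uv True by auto
  moreover have "u \<noteq> v" using uv by auto
  ultimately show thesis
    using that[of "{Inl u, Inl v}"] True by auto
next
  case False
  then obtain v where v: "v \<in> isolated_verts G" by auto
  obtain u a where ua: "(u, a) \<in> parcs G" using assms(2) by auto
  have u: "u \<in> pverts G" "u \<notin> isolated_verts G"
    using ua in_arcsD1 by (auto simp: isolated_verts_def)
  \<comment> \<open>An isolated vertex reaches only itself. Symmetry then reverses the statement,
    because \<open>u\<close>, having the neighbour \<open>a\<close>, must be the starting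
    vertex.\<close>
  have "\<not> v \<rightarrow>\<^sup>*\<^bsub>with_proj G\<^esub> u"
    using u v by (auto simp: isolated_verts_def elim: converse_reachable_cases)
  then have "\<not> u \<rightarrow>\<^sup>*\<^bsub>with_proj G\<^esub> v"
    using symmetric_reachable[OF pair_sym_arcs] by auto
  then have "m_hull_set (complementary_prism G) (Inl ` insert u (isolated_verts G))"
    using u v ua by (intro m_hull_setI[of _ u v a]) (auto simp: isolated_verts_def)
  moreover have "finite (isolated_verts G)"
    by (rule finite_subset[OF _ pair_finite_verts]) (auto simp: isolated_verts_def)
  then have "card (Inl ` insert u (isolated_verts G) :: ('a + 'a) set) = card (isolated_verts G) + 1"
    using u by (subst card_image) auto
  ultimately show thesis
    using that False by auto
qed

end

theorem theorem5p1:
  fixes G :: "'a pair_pre_digraph" and t :: nat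
  assumes "pair_graph G"
    and "\<not> connected (with_proj G)"
    and "parcs G \<noteq> {}"
    and "card (trivial_components G) = t"
  shows "monophonic_hull_number (complementary_prism G) = (if t = 0 then 2 else t + 1)"
proof -
  interpret pair_graph G by fact
  have t: "card (isolated_verts G) = t"
    using assms(4) card_trivial_components by simp
  \<comment> \<open>Finiteness is what makes cardinality 0 equivalent to emptiness, as infinite sets
    also have \<open>card\<close> 0.\<close>
  have "finite (isolated_verts G)"
    by (rule finite_subset[OF _ pair_finite_verts]) (auto simp: isolated_verts_def)
  then have "isolated_verts G = {} \<longleftrightarrow> t = 0"
    using t by auto
  then obtain S where S: "m_hull_set (complementary_prism G) S" "card S = (if t = 0 then 2 else t + 1)"
    using obtain_small_m_hull_set[OF assms(2,3)] t by metis
  \<comment> \<open>The bound 2 settles \<open>t = 0\<close>; otherwise the strict inequality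
    \<open>t < card T\<close> gives \<open>t + 1\<close>.\<close>
  have "(if t = 0 then 2 else t + 1) \<le> card T" if "m_hull_set (complementary_prism G) T" for T
    using card_m_hull_set_ge_2[OF that assms(3)] card_isolated_less_m_hull_set[OF that assms(3)] t
    by auto
  then show ?thesis
    unfolding monophonic_hull_number_def
    by (intro Least_equality) (use S in auto)
qed

end
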